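(* Let $p,h,k$ be positive integers. There is a bijection between $\mathcal S_{(p,h,k)}=\bigcup_{\alpha\in I_{(h,k)}}\mathcal S_{(p,h,k),\alpha}$ and the set of strongly stable monomial ideals $J\triangleleft\mathbf k[x_1,x_2,x_3]$ with $\mathsf N(J)$ finite whose Bar Code of $\mathsf N(J)$ has bar list $(p,h,k)$.
   Context: $\mathbf k$ is a field of characteristic $0$; terms ordered lexicographically with $x_1<x_2<x_3$. A monomial ideal $J$ is strongly stable if for every term $\tau\in J$ and every pair of variables $x_i<x_j$ with $x_i\mid\tau$, $x_j\tau/x_i\in J$; $\mathsf N(J)$ is the set of terms not in $J$. The bar list of (the Bar Code of) a finite set $M$ of terms is $(\mu(1),\mu(2),\mu(3))$ with $\mu(1)=|M|$, $\mu(2)=|\{x_2^{\gamma_2}x_3^{\gamma_3}: x^\gamma\in M\}|$, $\mu(3)=|\{x_3^{\gamma_3}:x^\gamma\in M\}|$. $I_{(h,k)}$ is the set of $(\alpha_1,\dots,\alpha_k)\in\mathbb N^k$ with $\alpha_1>\dots>\alpha_k>0$, $\sum\alpha_i=h$. For $\alpha\in I_{(h,k)}$, $\mathcal S_{(p,h,k),\alpha}$ is the set of shifted arrays $\pi=(\pi_{i,j})_{1\le i\le k,\ i\le j\le i+\alpha_i-1}$ of integers (shifted $(1,0)$-plane partitions of shape $\lambda=(\lambda_i)$, $\lambda_i=i+\alpha_i-1$) with $\pi_{i,j}>0$; $\pi_{i,j}>\pi_{i,j+1}$ for $i\le j<i+\alpha_i-1$; $\pi_{i,j}\ge\pi_{i+1,j}$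 for $1\le i\le k-1$ and $j$ with both entries defined; and $\sum_{i,j}\pi_{i,j}=p$. *)

theory Defs
  imports Complex_Main "HOL-Library.Poly_Mapping"
begin

datatype var = X1 | X2 | X3

fun var_index :: "var \<Rightarrow> nat" where
  "var_index X1 = 1"
| "var_index X2 = 2"
| "var_index X3 = 3"

lemma var_index_inject: "var_index x = var_index y \<longleftrightarrow> x = y"
  by (cases x; cases y) simp_all

instantiation var :: linorder
begin

definition less_eq_var :: "var \<Rightarrow> var \<Rightarrow> bool" where
  "x \<le> y \<longleftrightarrow> var_index x \<le> var_index y"

definition less_var :: "var \<Rightarrow> var \<Rightarrow> bool" where
  "x < y \<longleftrightarrow> var_index x < var_index y"

instance
  by standard (auto simp: less_eq_var_def less_var_def var_index_inject[symmetric])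

end

text \<open>A term is represented by its exponent vector, so the product of terms is written \<open>+\<close>.\<close>

type_synonym pterm = "var \<Rightarrow>\<^sub>0 nat"

type_synonym 'k poly3 = "pterm \<Rightarrow>\<^sub>0 'k"

definition term_poly :: "pterm \<Rightarrow> 'k::field poly3" where
  "term_poly \<tau> = Poly_Mapping.single \<tau> 1"

text \<open>Ideals are the submodules of a commutative ring viewed as a module over itself.\<close>

interpretation ideal: module "(*) :: 'a::comm_ring_1 \<Rightarrow> 'a \<Rightarrow> 'a"
  by standard (simp_all add: algebra_simps)

definition monomial_ideal :: "'k::field poly3 set \<Rightarrow> bool" where
  "monomial_ideal J \<longleftrightarrow> ideal.subspace J \<and> (\<exists>T. J = ideal.span (term_poly ` T))"

text \<open>The truncated subtraction below is the exact division \<open>x\<^sub>j \<tau> / x\<^sub>i\<close>, since \<open>x\<^sub>i\<close> divides \<open>\<tau>\<close>.\<close>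

definition strongly_stable :: "'k::field poly3 set \<Rightarrow> bool" where
  "strongly_stable J \<longleftrightarrow>
     (\<forall>\<tau> xi xj. term_poly \<tau> \<in> J \<longrightarrow> xi < xj \<longrightarrow> Poly_Mapping.lookup \<tau> xi > 0 \<longrightarrow>
        term_poly (Poly_Mapping.single xj 1 + \<tau> - Poly_Mapping.single xi 1) \<in> J)"

definition standard_terms :: "'k::field poly3 set \<Rightarrow> pterm set" where
  "standard_terms J = {\<tau>. term_poly \<tau> \<notin> J}"

text \<open>Meaningful for finite \<open>M\<close> only.\<close>

definition bar_list :: "pterm set \<Rightarrow> nat \<times> nat \<times> nat" where
  "bar_list M =
     (card M,
      card ((\<lambda>\<gamma>. Poly_Mapping.single X2 (Poly_Mapping.lookup \<gamma> X2)
                + Poly_Mapping.single X3 (Poly_Mapping.lookup \<gamma> X3)) ` M),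
      card ((\<lambda>\<gamma>. Poly_Mapping.single X3 (Poly_Mapping.lookup \<gamma> X3)) ` M))"

definition strict_partitions :: "nat \<Rightarrow> nat \<Rightarrow> nat list set" where
  "strict_partitions h k =
     {\<alpha>. length \<alpha> = k \<and> sorted_wrt (>) \<alpha> \<and> (\<forall>a \<in> set \<alpha>. a > 0) \<and> sum_list \<alpha> = h}"

text \<open>Rows and columns are numbered from 1, so \<open>\<alpha>\<^sub>i\<close> is \<open>\<alpha> ! (i - 1)\<close>.\<close>

definition shifted_diagram :: "nat list \<Rightarrow> (nat \<times> nat) set" where
  "shifted_diagram \<alpha> =
     {(i, j). 1 \<le> i \<and> i \<le> length \<alpha> \<and> i \<le> j \<and> j \<le> i + \<alpha> ! (i - 1) - 1}"

text \<open>An array is stored as a total function that is 0 outside its diagram. As the entries are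
  positive, the diagram is the support, so arrays of different shapes are different functions
  (with \<open>undefined\<close> in place of 0 they could coincide).\<close>

definition shifted_plane_partitions :: "nat \<Rightarrow> nat list \<Rightarrow> (nat \<Rightarrow> nat \<Rightarrow> int) set" where
  "shifted_plane_partitions p \<alpha> =
     {\<pi>. (\<forall>i j. (i, j) \<notin> shifted_diagram \<alpha> \<longrightarrow> \<pi> i j = 0) \<and>
         (\<forall>(i, j) \<in> shifted_diagram \<alpha>. \<pi> i j > 0) \<and>
         (\<forall>i j. (i, j) \<in> shifted_diagram \<alpha> \<longrightarrow> (i, j + 1) \<in> shifted_diagram \<alpha> \<longrightarrow>
            \<pi> i j > \<pi> i (j + 1)) \<and>
         (\<forall>i j. (i, j) \<in> shifted_diagram \<alpha> \<longrightarrow> (i + 1, j) \<in> shifted_diagram \<alpha> \<longrightarrow>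
            \<pi> i j \<ge> \<pi> (i + 1) j) \<and>
         (\<Sum>(i, j) \<in> shifted_diagram \<alpha>. \<pi> i j) = int p}"

end

theory Submission
  imports Defs
begin

text \<open>
  A monomial ideal with finite complement is determined by its standard terms, and these are
  determined by the heights \<open>n b c = #{a. x\<^sub>1\<^sup>a x\<^sub>2\<^sup>b x\<^sub>3\<^sup>c \<in> N(J)}\<close>. Put
  \<open>\<pi>\<^sub>i\<^sub>,\<^sub>j = n (j - i) (i - 1)\<close>. Exchanging \<open>x\<^sub>2\<close> for \<open>x\<^sub>1\<close> shows that
  the positive heights decrease strictly along rows; exchanging \<open>x\<^sub>3\<close> for \<open>x\<^sub>2\<close> moves to the
  preceding row without changing the column \<open>j\<close>, so columns decrease weakly. The exchange of \<open>x\<^sub>3\<close>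
  for \<open>x\<^sub>1\<close> and the order ideal property follow from these two. The bar list of \<open>N(J)\<close> consists of
  the sum of the array, the size of its support and its number of rows, and the two monotonicity
  conditions force the support to be the diagram of a strict partition.
\<close>

subsection \<open>Monomial ideals and order ideals of terms\<close>

text \<open>Since \<open>+\<close> multiplies terms, this is closure under divisors.\<close>

definition order_ideal :: "pterm set \<Rightarrow> bool" where
  "order_ideal N \<longleftrightarrow> (\<forall>\<sigma> \<tau>. \<sigma> + \<tau> \<in> N \<longrightarrow> \<tau> \<in> N)"

text \<open>Strong stability read on the complement, so that neither the ideal nor the field
  occurs.\<close>

definition stable_terms :: "pterm set \<Rightarrow> bool" where
  "stable_terms N \<longleftrightarrow>
     (\<forall>\<tau> xi xj. \<tau> \<notin> N \<longrightarrow> xi < xj \<longrightarrow> Poly_Mapping.lookup \<tau> xi > 0 \<longrightarrow>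
        Poly_Mapping.single xj 1 + \<tau> - Poly_Mapping.single xi 1 \<notin> N)"

text \<open>For an order ideal \<open>N\<close> this is the span of the terms outside
  \<open>N\<close>; describing it through \<open>keys\<close> makes membership of a single term
  immediate.\<close>

definition ideal_avoiding :: "pterm set \<Rightarrow> 'k::field poly3 set" where
  "ideal_avoiding N = {q. Poly_Mapping.keys q \<inter> N = {}}"

lemma keys_term_poly [simp]: "Poly_Mapping.keys (term_poly \<tau> :: 'k::field poly3) = {\<tau>}"
  by (simp add: term_poly_def)

lemma sum_single_lookup:
  fixes q :: "'a \<Rightarrow>\<^sub>0 'b::comm_monoid_add"
  shows "q = (\<Sum>\<tau>\<in>Poly_Mapping.keys q. Poly_Mapping.single \<tau> (Poly_Mapping.lookup q \<tau>))"
  by (rule poly_mapping_eqI)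
    (simp add: lookup_sum lookup_single when_def sum.delta in_keys_iff)

text \<open>Every key of \<open>c * x\<close> is a key of \<open>c\<close> plus a key of
  \<open>x\<close>; if it lay in \<open>N\<close>, so would its divisor, the key of
  \<open>x\<close>.\<close>

lemma subspace_ideal_avoiding:
  assumes "order_ideal N"
  shows "ideal.subspace (ideal_avoiding N :: 'k::field poly3 set)"
proof (rule ideal.subspaceI)
  show "(0 :: 'k poly3) \<in> ideal_avoiding N"
    by (simp add: ideal_avoiding_def)
next
  fix x y :: "'k poly3"
  assume "x \<in> ideal_avoiding N" "y \<in> ideal_avoiding N"
  then show "x + y \<in> ideal_avoiding N"
    using keys_add[of x y] by (auto simp: ideal_avoiding_def)
next
  fix c x :: "'k poly3"
  assume "x \<in> ideal_avoiding N"
  then show "c * x \<in> ideal_avoiding N"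
    using keys_mult[of c x] assms by (fastforce simp: ideal_avoiding_def order_ideal_def)
qed

lemma mem_subspace_if_terms:
  fixes J :: "'k::field poly3 set"
  assumes "ideal.subspace J" and "\<And>\<tau>. \<tau> \<in> Poly_Mapping.keys q \<Longrightarrow> term_poly \<tau> \<in> J"
  shows "q \<in> J"
proof -
  have "Poly_Mapping.single \<tau> (Poly_Mapping.lookup q \<tau>) \<in> J" if "\<tau> \<in> Poly_Mapping.keys q" for \<tau>
  proof -
    \<comment> \<open>Scalars of the module are polynomials, so a coefficient acts through a
      constant polynomial.\<close>
    have "Poly_Mapping.single 0 (Poly_Mapping.lookup q \<tau>) * term_poly \<tau> \<in> J"
      using assms that by (intro ideal.subspace_scale)
    then show ?thesis
      by (simp add: term_poly_def mult_single)
  qed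
  then have "(\<Sum>\<tau>\<in>Poly_Mapping.keys q. Poly_Mapping.single \<tau> (Poly_Mapping.lookup q \<tau>)) \<in> J"
    by (intro ideal.subspace_sum[OF assms(1)])
  then show ?thesis
    using sum_single_lookup[of q] by simp
qed

lemma standard_terms_ideal_avoiding [simp]:
  "standard_terms (ideal_avoiding N :: 'k::field poly3 set) = N"
  by (auto simp: standard_terms_def ideal_avoiding_def)

lemma monomial_ideal_avoiding:
  assumes "order_ideal N"
  shows "monomial_ideal (ideal_avoiding N :: 'k::field poly3 set)"
proof -
  let ?T = "term_poly ` (- N) :: 'k poly3 set"
  have "ideal_avoiding N = ideal.span ?T"
  proof
    show "ideal_avoiding N \<subseteq> ideal.span ?T"
    proof
      fix q :: "'k poly3"
      assume "q \<in> ideal_avoiding N"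
      then have "term_poly \<tau> \<in> ?T" if "\<tau> \<in> Poly_Mapping.keys q" for \<tau>
        using that by (auto simp: ideal_avoiding_def)
      then show "q \<in> ideal.span ?T"
        by (rule mem_subspace_if_terms[OF ideal.subspace_span ideal.span_base])
    qed
    show "ideal.span ?T \<subseteq> ideal_avoiding N"
      by (rule ideal.span_minimal[OF _ subspace_ideal_avoiding[OF assms]])
        (auto simp: ideal_avoiding_def)
  qed
  then show ?thesis
    using subspace_ideal_avoiding[OF assms] unfolding monomial_ideal_def by blast
qed

text \<open>Contrapositive of the closure of \<open>J\<close> under multiplication by terms.\<close>

lemma order_ideal_standard_terms:
  fixes J :: "'k::field poly3 set"
  assumes "ideal.subspace J"
  shows "order_ideal (standard_terms J)"
proof -
  have "term_poly (\<sigma> + \<tau>) \<in> J" if "term_poly \<tau> \<in> J" for \<sigma> \<tau>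
  proof -
    have "term_poly \<sigma> * term_poly \<tau> \<in> J"
      using assms that by (rule ideal.subspace_scale)
    then show ?thesis
      by (simp add: term_poly_def mult_single)
  qed
  then show ?thesis
    by (auto simp: order_ideal_def standard_terms_def)
qed

text \<open>An ideal contains every polynomial all of whose terms it contains. Generation by terms
  gives the other inclusion: the generators avoid the standard terms, and the polynomials avoiding
  them form an ideal, so minimality of the span applies.\<close>

lemma ideal_avoiding_standard_terms:
  fixes J :: "'k::field poly3 set"
  assumes "monomial_ideal J"
  shows "ideal_avoiding (standard_terms J) = J"
proof
  from assms obtain T where sub: "ideal.subspace J" and T: "J = ideal.span (term_poly ` T)"
    unfolding monomial_ideal_def by blast
  show "ideal_avoiding (standard_terms J) \<subseteq> J"
  proof
    fix q :: "'k poly3"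
    assume "q \<in> ideal_avoiding (standard_terms J)"
    then show "q \<in> J"
      using mem_subspace_if_terms[OF sub, of q] unfolding ideal_avoiding_def standard_terms_def
      by blast
  qed
  have "term_poly \<tau> \<in> J" if "\<tau> \<in> T" for \<tau>
    unfolding T using that by (intro ideal.span_base) simp
  then have "term_poly ` T \<subseteq> (ideal_avoiding (standard_terms J) :: 'k poly3 set)"
    by (auto simp: ideal_avoiding_def standard_terms_def)
  then show "J \<subseteq> ideal_avoiding (standard_terms J)"
    using ideal.span_minimal[OF _ subspace_ideal_avoiding[OF order_ideal_standard_terms[OF sub]]] T
    by blast
qed

lemma strongly_stable_iff:
  "strongly_stable J \<longleftrightarrow> stable_terms (standard_terms J)"
  by (simp add: strongly_stable_def stable_terms_def standard_terms_def)

lemma monomial_ideal_imp_subspace: "monomial_ideal J \<Longrightarrow> ideal.subspace J"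
  by (simp add: monomial_ideal_def)

text \<open>The inverse is \<open>standard_terms\<close>; stability, finiteness and bar list depend
  on \<open>J\<close> only through its standard terms.\<close>

lemma bij_betw_ideal_avoiding:
  "bij_betw ideal_avoiding
     {N. order_ideal N \<and> stable_terms N \<and> finite N \<and> bar_list N = (p, h, k)}
     {J :: 'k::field poly3 set. monomial_ideal J \<and> strongly_stable J \<and>
        finite (standard_terms J) \<and> bar_list (standard_terms J) = (p, h, k)}"
  by (rule bij_betw_byWitness[where f' = standard_terms])
    (auto simp: ideal_avoiding_standard_terms strongly_stable_iff monomial_ideal_avoiding
      dest: monomial_ideal_imp_subspace intro!: order_ideal_standard_terms)

subsection \<open>Arrays and their supports\<close>

definition support :: "(nat \<Rightarrow> nat \<Rightarrow> int) \<Rightarrow> (nat \<times> nat) set" where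
  "support \<pi> = {(i, j). \<pi> i j \<noteq> 0}"

text \<open>A version of the array conditions that mentions no shape. Strictness along a row is
  asked only before a nonzero entry, since the zeros past the end of a row repeat;
  \<open>i < j\<close> says that the cell below \<open>(i, j)\<close> is not left of the
  diagonal.\<close>

definition shifted_array :: "(nat \<Rightarrow> nat \<Rightarrow> int) \<Rightarrow> bool" where
  "shifted_array \<pi> \<longleftrightarrow>
     (\<forall>i j. \<pi> i j \<ge> 0) \<and> (\<forall>i j. \<pi> i j \<noteq> 0 \<longrightarrow> 1 \<le> i \<and> i \<le> j) \<and>
     (\<forall>i j. 1 \<le> i \<longrightarrow> i \<le> j \<longrightarrow> \<pi> i (j + 1) \<noteq> 0 \<longrightarrow> \<pi> i (j + 1) < \<pi> i j) \<and>
     (\<forall>i j. 1 \<le> i \<longrightarrow> i < j \<longrightarrow> \<pi> (i + 1) j \<le> \<pi> i j)"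

definition shifted_arrays :: "nat \<Rightarrow> nat \<Rightarrow> nat \<Rightarrow> (nat \<Rightarrow> nat \<Rightarrow> int) set" where
  "shifted_arrays p h k =
     {\<pi>. shifted_array \<pi> \<and> finite (support \<pi>) \<and> (\<Sum>(i, j) \<in> support \<pi>. \<pi> i j) = int p \<and>
         card (support \<pi>) = h \<and> card (fst ` support \<pi>) = k}"

text \<open>Descending from the maximum reaches every number down to \<open>m\<close>. This will
  apply to the rows of a support, to the set of nonempty rows and to the exponents of
  \<open>X1\<close> over fixed exponents of \<open>X2\<close> and \<open>X3\<close>.\<close>

lemma eq_atLeastLessThan_if_down_closed:
  fixes A :: "nat set"
  assumes "finite A" and "\<And>x. x \<in> A \<Longrightarrow> m \<le> x" and "\<And>x. m \<le> x \<Longrightarrow> Suc x \<in> A \<Longrightarrow> x \<in> A"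
  shows "A = {m..<m + card A}"
proof (cases "A = {}")
  case False
  have mem: "x \<in> A" if "m \<le> x" "x \<le> Max A" for x
    using that(2,1)
  proof (induction rule: inc_induct)
    case base
    show ?case by (rule Max_in[OF assms(1) False])
  next
    case (step n)
    show ?case by (rule assms(3)) (use step in simp_all)
  qed
  have A: "A = {m..Max A}"
  proof (intro equalityI subsetI)
    fix x assume "x \<in> A"
    then show "x \<in> {m..Max A}"
      using assms(2)[of x] Max_ge[OF assms(1)] by simp
  next
    fix x assume "x \<in> {m..Max A}"
    then show "x \<in> A" by (intro mem) simp_all
  qed
  have "m \<le> Max A"
    by (rule assms(2)[OF Max_in[OF assms(1) False]])
  moreover have "card A = Suc (Max A) - m"
    by (subst A) (rule card_atLeastAtMost)
  ultimately have "{m..Max A} = {m..<m + card A}"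
    by (simp add: atLeastLessThanSuc_atLeastAtMost)
  with A show ?thesis by (rule trans)
qed simp

section \<open>Shifted diagrams of strict partitions\<close>

lemma shifted_diagram_Sigma:
  "shifted_diagram \<alpha> = (SIGMA i:{1..length \<alpha>}. {i..i + \<alpha> ! (i - 1) - 1})"
  by (auto simp: shifted_diagram_def)

lemma finite_shifted_diagram: "finite (shifted_diagram \<alpha>)"
  by (simp add: shifted_diagram_Sigma)

lemma card_shifted_diagram: "card (shifted_diagram \<alpha>) = sum_list \<alpha>"
proof -
  have "card (shifted_diagram \<alpha>) = (\<Sum>i\<in>{1..length \<alpha>}. card {i..i + \<alpha> ! (i - 1) - 1})"
    by (simp add: shifted_diagram_Sigma)
  \<comment> \<open>As \<open>i\<close> is at least 1, a part 0 gives the upper end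
    \<open>i - 1\<close> and hence an empty row, as it should.\<close>
  also have "\<dots> = (\<Sum>i\<in>{1..length \<alpha>}. \<alpha> ! (i - 1))"
    by (rule sum.cong) auto
  also have "\<dots> = (\<Sum>i\<in>{0..<length \<alpha>}. \<alpha> ! i)"
    by (rule sum.reindex_bij_witness[of _ Suc "\<lambda>i. i - 1"]) auto
  finally show ?thesis
    by (simp add: sum_list_sum_nth)
qed

lemma fst_shifted_diagram:
  assumes "\<forall>a \<in> set \<alpha>. a > 0"
  shows "fst ` shifted_diagram \<alpha> = {1..length \<alpha>}"
proof -
  have "\<alpha> ! (i - 1) > 0" if "i \<in> {1..length \<alpha>}" for i
    using assms that by (auto intro!: bspec[OF assms] nth_mem)
  then show ?thesis
    by (force simp: shifted_diagram_Sigma)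
qed

lemma shifted_diagram_left:
  assumes "(i, j + 1) \<in> shifted_diagram \<alpha>" "i \<le> j"
  shows "(i, j) \<in> shifted_diagram \<alpha>"
  using assms by (auto simp: shifted_diagram_def)

text \<open>Row \<open>i + 1\<close> starts one place further right but is shorter by at least one
  cell, so it ends no further right than row \<open>i\<close>.\<close>

lemma shifted_diagram_up:
  assumes "sorted_wrt (>) \<alpha>" "(i + 1, j) \<in> shifted_diagram \<alpha>" "1 \<le> i"
  shows "(i, j) \<in> shifted_diagram \<alpha>"
proof -
  have "\<alpha> ! (i - 1) > \<alpha> ! i"
    using assms by (intro sorted_wrt_nth_less[OF assms(1)]) (auto simp: shifted_diagram_def)
  then show ?thesis
    using assms by (auto simp: shifted_diagram_def)
qed

text \<open>Positivity makes the diagram the support. The diagram is closed to the left and upwards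
  within the region \<open>1 \<le> i \<le> j\<close>, so inequalities between two cells of the
  diagram extend to the shape-free ones.\<close>

lemma shifted_plane_partition_imp_shifted_array:
  assumes \<alpha>: "\<alpha> \<in> strict_partitions h k" and \<pi>: "\<pi> \<in> shifted_plane_partitions p \<alpha>"
  shows "\<pi> \<in> shifted_arrays p h k"
proof -
  let ?D = "shifted_diagram \<alpha>"
  have zero: "\<pi> i j = 0" if "(i, j) \<notin> ?D" for i j
    using \<pi> that by (auto simp: shifted_plane_partitions_def)
  have pos: "\<pi> i j > 0" if "(i, j) \<in> ?D" for i j
    using \<pi> that by (auto simp: shifted_plane_partitions_def)
  have row: "\<pi> i (j + 1) < \<pi> i j" if "(i, j + 1) \<in> ?D" "i \<le> j" for i j
    using \<pi> that shifted_diagram_left[OF that] by (auto simp: shifted_plane_partitions_def)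
  have srt: "sorted_wrt (>) \<alpha>" and alpos: "\<forall>a \<in> set \<alpha>. a > 0"
    and len: "length \<alpha> = k" and sm: "sum_list \<alpha> = h"
    using \<alpha> by (auto simp: strict_partitions_def)
  have col: "\<pi> (i + 1) j \<le> \<pi> i j" if "(i + 1, j) \<in> ?D" "1 \<le> i" for i j
    using \<pi> that shifted_diagram_up[OF srt that] by (auto simp: shifted_plane_partitions_def)
  have nonneg: "\<pi> i j \<ge> 0" for i j
    using zero[of i j] pos[of i j] by fastforce
  have supp: "support \<pi> = ?D"
    using zero pos by (fastforce simp: support_def)
  have "shifted_array \<pi>"
    unfolding shifted_array_def
  proof (intro conjI allI impI)
    fix i j assume "\<pi> i j \<noteq> 0"
    then have "(i, j) \<in> ?D" using zero by blast
    then show "1 \<le> i" "i \<le> j" by (auto simp: shifted_diagram_def)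
  next
    fix i j assume "i \<le> j" "\<pi> i (j + 1) \<noteq> 0"
    then show "\<pi> i (j + 1) < \<pi> i j" using zero row by blast
  next
    fix i j :: nat assume "1 \<le> i"
    then show "\<pi> (i + 1) j \<le> \<pi> i j"
      using col[of i j] zero[of "i + 1" j] nonneg[of i j] by fastforce
  qed (rule nonneg)
  moreover have "(\<Sum>(i, j) \<in> ?D. \<pi> i j) = int p"
    using \<pi> by (simp add: shifted_plane_partitions_def)
  ultimately show ?thesis
    using fst_shifted_diagram[OF alpos]
    by (simp add: shifted_arrays_def supp finite_shifted_diagram card_shifted_diagram sm len)
qed

text \<open>Both monotonicity conditions propagate nonzero entries, to the left up to the diagonal
  and upwards. Hence each nonempty row is an interval starting on the diagonal, and the row lengths
  form the partition.\<close>

lemma support_eq_shifted_diagram: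
  assumes arr: "shifted_array \<pi>" and fin: "finite (support \<pi>)"
  obtains \<alpha> where "sorted_wrt (>) \<alpha>" "\<forall>a \<in> set \<alpha>. a > 0" "support \<pi> = shifted_diagram \<alpha>"
proof -
  let ?S = "support \<pi>"
  have nonneg: "\<pi> i j \<ge> 0" for i j
    using arr by (simp add: shifted_array_def)
  have dom: "1 \<le> i" "i \<le> j" if "(i, j) \<in> ?S" for i j
    using arr that by (auto simp: shifted_array_def support_def)
  have left: "(i, j) \<in> ?S" if "(i, Suc j) \<in> ?S" "i \<le> j" for i j
  proof -
    have "\<pi> i (j + 1) < \<pi> i j"
      using arr dom[of i "Suc j"] that by (auto simp: shifted_array_def support_def)
    then show ?thesis
      using nonneg[of i "Suc j"] by (auto simp: support_def)
  qed
  have up: "(i, j) \<in> ?S" if "(Suc i, j) \<in> ?S" "1 \<le> i" for i j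
  proof -
    have "i < j"
      using dom[of "Suc i" j] that by simp
    then have "\<pi> (i + 1) j \<le> \<pi> i j"
      using arr that(2) unfolding shifted_array_def by blast
    then show ?thesis
      using that nonneg[of "Suc i" j] by (auto simp: support_def)
  qed
  define row where "row i = {j. (i, j) \<in> ?S}" for i
  have fin_row: "finite (row i)" for i
    by (rule finite_subset[OF _ finite_imageI[OF fin, of snd]]) (force simp: row_def)
  have row: "row i = {i..<i + card (row i)}" for i
    by (rule eq_atLeastLessThan_if_down_closed) (use fin_row dom left in \<open>auto simp: row_def\<close>)
  define l where "l = card (fst ` ?S)"
  have diag: "(i, i) \<in> ?S" if "row i \<noteq> {}" for i
  proof -
    have "i \<in> row i" using that by (subst row) (subst (asm) row, simp)
    then show ?thesis by (simp add: row_def)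
  qed
  \<comment> \<open>No row is skipped, because nonzero entries propagate upwards.\<close>
  have "fst ` ?S = {1..<1 + l}"
    unfolding l_def
  proof (rule eq_atLeastLessThan_if_down_closed)
    fix i assume "1 \<le> i" "Suc i \<in> fst ` ?S"
    then obtain j where "(Suc i, j) \<in> ?S" by auto
    then show "i \<in> fst ` ?S" using up \<open>1 \<le> i\<close> by (metis fst_conv imageI)
  qed (use fin dom in auto)
  moreover have "row i \<noteq> {} \<longleftrightarrow> i \<in> fst ` ?S" for i
    unfolding row_def by (auto intro: rev_image_eqI)
  ultimately have rows: "row i \<noteq> {} \<longleftrightarrow> 1 \<le> i \<and> i \<le> l" for i
    by auto
  \<comment> \<open>Lists are indexed from 0 and rows from 1, hence \<open>Suc i\<close>.\<close>
  define \<alpha> where "\<alpha> = map (\<lambda>i. card (row (Suc i))) [0..<l]"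
  \<comment> \<open>Consecutive rows are nested; the inclusion is proper because the diagonal cell
    of the upper row lies left of where the lower row starts.\<close>
  have "card (row (Suc (Suc i))) < card (row (Suc i))" if "Suc i < l" for i
  proof (rule psubset_card_mono[OF fin_row])
    have "Suc i \<in> row (Suc i)"
      using rows[of "Suc i"] diag that by (auto simp: row_def)
    moreover have "Suc i \<notin> row (Suc (Suc i))"
      using dom(2)[of "Suc (Suc i)" "Suc i"] unfolding row_def by auto
    moreover have "row (Suc (Suc i)) \<subseteq> row (Suc i)"
      using up by (auto simp: row_def)
    ultimately show "row (Suc (Suc i)) \<subset> row (Suc i)" by blast
  qed
  then have "sorted_wrt (>) \<alpha>"
    by (subst sorted_wrt_iff_nth_Suc_transp) (auto simp: \<alpha>_def intro!: transpI)
  moreover have "card (row (Suc i)) > 0" if "i < l" for i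
    using rows[of "Suc i"] fin_row that by (simp add: card_gt_0_iff)
  then have pos: "\<forall>a \<in> set \<alpha>. a > 0"
    by (auto simp: \<alpha>_def)
  moreover have "?S = shifted_diagram \<alpha>"
  proof -
    have "(i, j) \<in> ?S \<longleftrightarrow> (i, j) \<in> shifted_diagram \<alpha>" for i j
    proof (cases "1 \<le> i \<and> i \<le> l")
      case True
      then have "card (row i) > 0"
        using rows[of i] fin_row by (simp add: card_gt_0_iff)
      moreover have "(i, j) \<in> ?S \<longleftrightarrow> j \<in> {i..<i + card (row i)}"
        by (subst row[symmetric]) (simp add: row_def)
      ultimately show ?thesis
        using True by (auto simp: shifted_diagram_def \<alpha>_def)
    next
      case False
      then show ?thesis
        using rows[of i] by (auto simp: shifted_diagram_def \<alpha>_def row_def)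
    qed
    then show ?thesis by auto
  qed
  ultimately show ?thesis using that by blast
qed

lemma shifted_array_imp_shifted_plane_partition:
  assumes "\<pi> \<in> shifted_arrays p h k"
  shows "\<exists>\<alpha> \<in> strict_partitions h k. \<pi> \<in> shifted_plane_partitions p \<alpha>"
proof -
  have arr: "shifted_array \<pi>" and fin: "finite (support \<pi>)"
    and p: "(\<Sum>(i, j) \<in> support \<pi>. \<pi> i j) = int p"
    and h: "card (support \<pi>) = h" and k: "card (fst ` support \<pi>) = k"
    using assms by (auto simp: shifted_arrays_def)
  obtain \<alpha> where \<alpha>: "sorted_wrt (>) \<alpha>" "\<forall>a \<in> set \<alpha>. a > 0" and S: "support \<pi> = shifted_diagram \<alpha>"
    using support_eq_shifted_diagram[OF arr fin] by blast
  have mem: "(i, j) \<in> shifted_diagram \<alpha> \<longleftrightarrow> \<pi> i j \<noteq> 0" for i j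
    using S by (auto simp: support_def)
  have dom: "1 \<le> i \<and> i \<le> j" if "\<pi> i j \<noteq> 0" for i j
    using arr that by (auto simp: shifted_array_def)
  have "\<alpha> \<in> strict_partitions h k"
    using \<alpha> h k by (simp add: strict_partitions_def S card_shifted_diagram fst_shifted_diagram)
  moreover have "\<pi> \<in> shifted_plane_partitions p \<alpha>"
    unfolding shifted_plane_partitions_def
  proof (intro CollectI conjI allI impI)
    show "\<forall>(i, j) \<in> shifted_diagram \<alpha>. \<pi> i j > 0"
      using arr by (auto simp: mem shifted_array_def order.strict_iff_order)
  next
    fix i j assume "(i, j) \<in> shifted_diagram \<alpha>" "(i, j + 1) \<in> shifted_diagram \<alpha>"
    then show "\<pi> i (j + 1) < \<pi> i j"
      using arr dom[of i j] unfolding mem by (simp add: shifted_array_def)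
  next
    fix i j assume "(i, j) \<in> shifted_diagram \<alpha>" "(i + 1, j) \<in> shifted_diagram \<alpha>"
    then have "1 \<le> i" "i < j"
      using dom[of i j] dom[of "i + 1" j] unfolding mem by simp_all
    then show "\<pi> (i + 1) j \<le> \<pi> i j"
      using arr unfolding shifted_array_def by blast
  qed (use mem p S in auto)
  ultimately show ?thesis by blast
qed

text \<open>Removes the shapes from the problem: each is recovered from the support.\<close>

lemma UN_shifted_plane_partitions:
  "(\<Union>\<alpha> \<in> strict_partitions h k. shifted_plane_partitions p \<alpha>) = shifted_arrays p h k"
  by (rule set_eqI)
    (meson UN_iff shifted_plane_partition_imp_shifted_array
      shifted_array_imp_shifted_plane_partition)

subsection \<open>Arrays and stable order ideals\<close>

definition mon :: "nat \<Rightarrow> nat \<Rightarrow> nat \<Rightarrow> pterm" where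
  "mon a b c = Poly_Mapping.single X1 a + Poly_Mapping.single X2 b + Poly_Mapping.single X3 c"

text \<open>Exponents \<open>b\<close> of \<open>X2\<close> and \<open>c\<close> of
  \<open>X3\<close> belong to the cell \<open>(c + 1, b + c + 1)\<close>; its entry counts the
  admissible exponents of \<open>X1\<close>, so 0 admits none.\<close>

definition terms_below :: "(nat \<Rightarrow> nat \<Rightarrow> int) \<Rightarrow> pterm set" where
  "terms_below \<pi> =
     {\<tau>. int (Poly_Mapping.lookup \<tau> X1) <
        \<pi> (Poly_Mapping.lookup \<tau> X3 + 1) (Poly_Mapping.lookup \<tau> X2 + Poly_Mapping.lookup \<tau> X3 + 1)}"

text \<open>The default 0 keeps truncated subtraction from creating values in row 0 and left of the
  diagonal.\<close>

definition heights :: "pterm set \<Rightarrow> nat \<Rightarrow> nat \<Rightarrow> int" where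
  "heights N i j = (if 1 \<le> i \<and> i \<le> j then int (card {a. mon a (j - i) (i - 1) \<in> N}) else 0)"

lemma lookup_mon [simp]:
  "Poly_Mapping.lookup (mon a b c) X1 = a"
  "Poly_Mapping.lookup (mon a b c) X2 = b"
  "Poly_Mapping.lookup (mon a b c) X3 = c"
  by (simp_all add: mon_def lookup_add lookup_single)

lemma pterm_eq_iff:
  fixes \<sigma> \<tau> :: pterm
  shows "\<sigma> = \<tau> \<longleftrightarrow> Poly_Mapping.lookup \<sigma> X1 = Poly_Mapping.lookup \<tau> X1 \<and>
    Poly_Mapping.lookup \<sigma> X2 = Poly_Mapping.lookup \<tau> X2 \<and>
    Poly_Mapping.lookup \<sigma> X3 = Poly_Mapping.lookup \<tau> X3"
    (is "_ = ?R")
proof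
  assume ?R
  then have "Poly_Mapping.lookup \<sigma> x = Poly_Mapping.lookup \<tau> x" for x
    by (cases x) simp_all
  then show "\<sigma> = \<tau>" by (rule poly_mapping_eqI)
qed simp

lemma mon_eq_iff [simp]: "mon a b c = mon a' b' c' \<longleftrightarrow> a = a' \<and> b = b' \<and> c = c'"
  by (simp add: pterm_eq_iff)

lemma mon_lookup [simp]:
  "mon (Poly_Mapping.lookup \<tau> X1) (Poly_Mapping.lookup \<tau> X2) (Poly_Mapping.lookup \<tau> X3) = \<tau>"
  by (simp add: pterm_eq_iff)

lemma mon_mem_terms_below [simp]:
  "mon a b c \<in> terms_below \<pi> \<longleftrightarrow> int a < \<pi> (c + 1) (b + c + 1)"
  by (simp add: terms_below_def)

lemma order_ideal_mon:
  assumes "order_ideal N" "mon (Suc a) b c \<in> N"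
  shows "mon a b c \<in> N"
proof -
  have "mon (Suc a) b c = mon 1 0 0 + mon a b c"
    by (simp add: pterm_eq_iff lookup_add)
  then show ?thesis
    using assms unfolding order_ideal_def by metis
qed

text \<open>Contrapositives of the exchanges between adjacent variables; \<open>move\<close> is
  applied to the term before the exchange.\<close>

lemma stable_terms_mon:
  assumes "stable_terms N"
  shows "mon a (Suc b) c \<in> N \<Longrightarrow> mon (Suc a) b c \<in> N"
    and "mon a b (Suc c) \<in> N \<Longrightarrow> mon a (Suc b) c \<in> N"
proof -
  have move: "Poly_Mapping.single xj 1 + \<tau> - Poly_Mapping.single xi 1 \<in> N \<Longrightarrow> \<tau> \<in> N"
    if "xi < xj" "Poly_Mapping.lookup \<tau> xi > 0" for \<tau> xi xj
    using assms that unfolding stable_terms_def by blast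
  have "Poly_Mapping.single X2 1 + mon (Suc a) b c - Poly_Mapping.single X1 1 = mon a (Suc b) c"
    by (simp add: pterm_eq_iff lookup_add lookup_minus lookup_single)
  then show "mon a (Suc b) c \<in> N \<Longrightarrow> mon (Suc a) b c \<in> N"
    using move[of X1 X2 "mon (Suc a) b c"] by (simp add: less_var_def)
  have "Poly_Mapping.single X3 1 + mon a (Suc b) c - Poly_Mapping.single X2 1 = mon a b (Suc c)"
    by (simp add: pterm_eq_iff lookup_add lookup_minus lookup_single)
  then show "mon a b (Suc c) \<in> N \<Longrightarrow> mon a (Suc b) c \<in> N"
    using move[of X2 X3 "mon a (Suc b) c"] by (simp add: less_var_def)
qed

section \<open>The order ideal of a shifted array\<close>

context
  fixes \<pi> :: "nat \<Rightarrow> nat \<Rightarrow> int"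
  assumes arr: "shifted_array \<pi>"
begin

lemma shifted_array_nonneg: "\<pi> i j \<ge> 0"
  using arr by (simp add: shifted_array_def)

lemma shifted_array_dom: "\<pi> i j \<noteq> 0 \<Longrightarrow> 1 \<le> i \<and> i \<le> j"
  using arr by (simp add: shifted_array_def)

text \<open>The premise makes the right-hand neighbour nonzero, which activates strictness and
  leaves room for one more power of \<open>X1\<close>.\<close>

lemma shifted_array_row:
  "int a < \<pi> (Suc c) (Suc (Suc (b + c))) \<Longrightarrow> int (Suc a) < \<pi> (Suc c) (Suc (b + c))"
proof -
  assume a: "int a < \<pi> (Suc c) (Suc (Suc (b + c)))"
  then have "\<pi> (Suc c) (Suc (b + c) + 1) < \<pi> (Suc c) (Suc (b + c))"
    using arr by (simp add: shifted_array_def)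
  then show ?thesis using a by simp
qed

lemma shifted_array_col:
  "\<pi> (Suc (Suc c)) (Suc (Suc (b + c))) \<le> \<pi> (Suc c) (Suc (Suc (b + c)))"
  using arr by (simp add: shifted_array_def)

lemma order_ideal_terms_below: "order_ideal (terms_below \<pi>)"
proof -
  \<comment> \<open>For a positive entry the row lemma is used with the largest integer below it; a
    zero entry is covered by nonnegativity.\<close>
  have b: "\<pi> (Suc c) (Suc (Suc (b + c))) \<le> \<pi> (Suc c) (Suc (b + c))" for b c
    using shifted_array_row[of "nat (\<pi> (Suc c) (Suc (Suc (b + c))) - 1)" c b]
      shifted_array_nonneg[of "Suc c" "Suc (b + c)"]
      shifted_array_nonneg[of "Suc c" "Suc (Suc (b + c))"] by linarith
  have "\<pi> (Suc c) (Suc (b' + b + c)) \<le> \<pi> (Suc c) (Suc (b + c))" for b b' c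
    using lift_Suc_antimono_le[of "\<lambda>b. \<pi> (Suc c) (Suc (b + c))" b "b' + b"] b by simp
  \<comment> \<open>Lowering the exponent of \<open>X3\<close> by one is a column step, which raises
    that of \<open>X2\<close>, followed by a row step, which lowers it again.\<close>
  moreover have "\<pi> (Suc (c' + c)) (Suc (b + (c' + c))) \<le> \<pi> (Suc c) (Suc (b + c))" for b c c'
    using lift_Suc_antimono_le[of "\<lambda>c. \<pi> (Suc c) (Suc (b + c))" c "c' + c"]
      order_trans[OF shifted_array_col b] by simp
  ultimately have "\<pi> (Suc (c' + c)) (Suc (b' + b + (c' + c))) \<le> \<pi> (Suc c) (Suc (b + c))" for b b' c c'
    by (meson order_trans)
  then have "int a < \<pi> (Suc c) (Suc (b + c))"
    if "int (a' + a) < \<pi> (Suc (c' + c)) (Suc (b' + b + (c' + c)))" for a a' b b' c c'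
    using that by (smt (verit) of_nat_add of_nat_0_le_iff)
  then show ?thesis
    unfolding order_ideal_def terms_below_def by (simp add: lookup_add)
qed

lemma stable_terms_terms_below: "stable_terms (terms_below \<pi>)"
  unfolding stable_terms_def
proof (intro allI impI notI)
  fix \<tau> :: pterm and xi xj
  define a b c where abc: "a = Poly_Mapping.lookup \<tau> X1" "b = Poly_Mapping.lookup \<tau> X2"
    "c = Poly_Mapping.lookup \<tau> X3"
  have \<tau>: "\<tau> = mon a b c" by (simp add: abc)
  assume nin: "\<tau> \<notin> terms_below \<pi>" and xij: "xi < xj" and pos: "Poly_Mapping.lookup \<tau> xi > 0"
    and moved: "Poly_Mapping.single xj 1 + \<tau> - Poly_Mapping.single xi 1 \<in> terms_below \<pi>"
  consider "xi = X1" "xj = X2" | "xi = X1" "xj = X3" | "xi = X2" "xj = X3"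
    using xij by (cases xi; cases xj) (auto simp: less_var_def)
  then show False
  proof cases
    case 1
    then obtain a' where a': "a = Suc a'"
      using pos \<tau> by (cases a) auto
    have "Poly_Mapping.single xj 1 + \<tau> - Poly_Mapping.single xi 1 = mon a' (Suc b) c"
      by (simp add: 1 \<tau> a' pterm_eq_iff lookup_add lookup_minus lookup_single)
    with moved nin show False
      using shifted_array_row[of a' c b] by (simp add: \<tau> a')
  next
    \<comment> \<open>The exchange of \<open>X3\<close> for \<open>X1\<close> passes through
      \<open>mon a' (Suc b) c\<close>.\<close>
    case 2
    then obtain a' where a': "a = Suc a'"
      using pos \<tau> by (cases a) auto
    have "Poly_Mapping.single xj 1 + \<tau> - Poly_Mapping.single xi 1 = mon a' b (Suc c)"
      by (simp add: 2 \<tau> a' pterm_eq_iff lookup_add lookup_minus lookup_single)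
    with moved nin show False
      using shifted_array_row[of a' c b] shifted_array_col[of c b] by (simp add: \<tau> a')
  next
    case 3
    then obtain b' where b': "b = Suc b'"
      using pos \<tau> by (cases b) auto
    have "Poly_Mapping.single xj 1 + \<tau> - Poly_Mapping.single xi 1 = mon a b' (Suc c)"
      by (simp add: 3 \<tau> b' pterm_eq_iff lookup_add lookup_minus lookup_single)
    with moved nin show False
      using shifted_array_col[of c b'] by (simp add: \<tau> b')
  qed
qed

lemma heights_terms_below: "heights (terms_below \<pi>) = \<pi>"
proof (intro ext)
  fix i j
  show "heights (terms_below \<pi>) i j = \<pi> i j"
  proof (cases "1 \<le> i \<and> i \<le> j")
    case True
    then have "{a. mon a (j - i) (i - 1) \<in> terms_below \<pi>} = {..<nat (\<pi> i j)}"
      by auto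
    then show ?thesis
      using True shifted_array_nonneg[of i j] by (simp add: heights_def)
  next
    case False
    then show ?thesis
      using shifted_array_dom[of i j] by (auto simp: heights_def)
  qed
qed

text \<open>Indexing the terms by a cell and an exponent of \<open>X1\<close> serves both finiteness
  and counting.\<close>

lemma terms_below_eq_image:
  "terms_below \<pi> =
     (\<lambda>((i, j), a). mon a (j - i) (i - 1)) ` (SIGMA (i, j):support \<pi>. {..<nat (\<pi> i j)})"
  (is "_ = ?f ` ?S")
proof
  show "terms_below \<pi> \<subseteq> ?f ` ?S"
  proof
    fix \<tau> :: pterm
    define a b c where abc: "a = Poly_Mapping.lookup \<tau> X1" "b = Poly_Mapping.lookup \<tau> X2"
      "c = Poly_Mapping.lookup \<tau> X3"
    assume "\<tau> \<in> terms_below \<pi>"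
    then have "((c + 1, b + c + 1), a) \<in> ?S"
      by (auto simp: terms_below_def abc support_def)
    then show "\<tau> \<in> ?f ` ?S"
      by (rule rev_image_eqI) (simp add: abc)
  qed
  show "?f ` ?S \<subseteq> terms_below \<pi>"
    using shifted_array_dom by (fastforce simp: support_def)
qed

text \<open>On the support \<open>1 \<le> i \<le> j\<close>, so the truncated subtractions are
  exact.\<close>

lemma inj_on_index:
  "inj_on (\<lambda>((i, j), a). mon a (j - i) (i - 1)) (SIGMA (i, j):support \<pi>. {..<nat (\<pi> i j)})"
proof (rule inj_onI, clarsimp)
  fix i j i' j'
  assume "(i, j) \<in> support \<pi>" "(i', j') \<in> support \<pi>" "j - i = j' - i'" "i - Suc 0 = i' - Suc 0"
  then show "i = i' \<and> j = j'"
    using shifted_array_dom[of i j] shifted_array_dom[of i' j'] by (simp add: support_def) arith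
qed

text \<open>The fibre over a cell of the support is finite and contains the exponent 0, so the index
  set is finite exactly when its projection, the support, is.\<close>

lemma finite_terms_below_iff: "finite (terms_below \<pi>) \<longleftrightarrow> finite (support \<pi>)"
proof -
  let ?S = "SIGMA (i, j):support \<pi>. {..<nat (\<pi> i j)}"
  have "fst ` ?S = support \<pi>"
  proof
    show "support \<pi> \<subseteq> fst ` ?S"
    proof
      fix x assume x: "x \<in> support \<pi>"
      then have "(x, 0) \<in> ?S"
        using shifted_array_nonneg[of "fst x" "snd x"]
        by (auto simp: support_def order.strict_iff_order)
      then show "x \<in> fst ` ?S" by (rule rev_image_eqI) simp
    qed
  qed auto
  then have "finite ?S \<longleftrightarrow> finite (support \<pi>)"
    by (metis (no_types, lifting) case_prod_conv finite_SigmaI finite_imageI finite_lessThan surj_pair)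
  then show ?thesis
    unfolding terms_below_eq_image finite_image_iff[OF inj_on_index] .
qed

lemma bar_list_terms_below:
  assumes "finite (support \<pi>)"
  shows "bar_list (terms_below \<pi>) =
    (nat (\<Sum>(i, j) \<in> support \<pi>. \<pi> i j), card (support \<pi>), card (fst ` support \<pi>))"
proof -
  let ?S = "SIGMA (i, j):support \<pi>. {..<nat (\<pi> i j)}"
  let ?g = "\<lambda>\<gamma> :: pterm. Poly_Mapping.single X2 (Poly_Mapping.lookup \<gamma> X2)
                + Poly_Mapping.single X3 (Poly_Mapping.lookup \<gamma> X3)"
  have "card (terms_below \<pi>) = card ?S"
    unfolding terms_below_eq_image card_image[OF inj_on_index] ..
  also have "\<dots> = (\<Sum>(i, j) \<in> support \<pi>. nat (\<pi> i j))"
    using assms by (simp add: case_prod_unfold)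
  \<comment> \<open>Entries are nonnegative, so \<open>nat\<close> may be moved out of the
    sum.\<close>
  also have "\<dots> = nat (\<Sum>(i, j) \<in> support \<pi>. \<pi> i j)"
  proof -
    have "int (\<Sum>(i, j) \<in> support \<pi>. nat (\<pi> i j)) = (\<Sum>(i, j) \<in> support \<pi>. \<pi> i j)"
      using shifted_array_nonneg by (simp add: case_prod_unfold)
    then show ?thesis by (metis nat_int)
  qed
  finally have 1: "card (terms_below \<pi>) = nat (\<Sum>(i, j) \<in> support \<pi>. \<pi> i j)" .
  have supp: "(i, j) \<in> support \<pi> \<longleftrightarrow> 1 \<le> i \<and> i \<le> j \<and> 0 < \<pi> i j" for i j
    unfolding support_def using shifted_array_dom[of i j] shifted_array_nonneg[of i j] by fastforce
  \<comment> \<open>Setting the exponent of \<open>X1\<close> to 0 shows that the cell of a term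
    below \<open>\<pi>\<close> has a positive entry.\<close>
  have drop: "mon 0 (Poly_Mapping.lookup \<tau> X2) (Poly_Mapping.lookup \<tau> X3) \<in> terms_below \<pi>"
    if "\<tau> \<in> terms_below \<pi>" for \<tau>
    using that by (simp add: terms_below_def)
  have "bij_betw (\<lambda>(i, j). mon 0 (j - i) (i - 1)) (support \<pi>) (?g ` terms_below \<pi>)"
    unfolding bij_betw_def
  proof
    show "inj_on (\<lambda>(i, j). mon 0 (j - i) (i - 1)) (support \<pi>)"
      by (rule inj_onI) (auto simp: supp)
    show "(\<lambda>(i, j). mon 0 (j - i) (i - 1)) ` support \<pi> = ?g ` terms_below \<pi>"
    proof (intro equalityI subsetI)
      fix \<sigma> assume "\<sigma> \<in> (\<lambda>(i, j). mon 0 (j - i) (i - 1)) ` support \<pi>"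
      then obtain i j where "(i, j) \<in> support \<pi>" "\<sigma> = mon 0 (j - i) (i - 1)" by auto
      then show "\<sigma> \<in> ?g ` terms_below \<pi>"
        by (intro rev_image_eqI[of \<sigma>])
          (simp_all add: supp pterm_eq_iff terms_below_def lookup_add lookup_single)
    next
      fix \<sigma> assume "\<sigma> \<in> ?g ` terms_below \<pi>"
      then obtain \<tau> where \<tau>: "\<tau> \<in> terms_below \<pi>" "\<sigma> = ?g \<tau>" by auto
      define b c where bc: "b = Poly_Mapping.lookup \<tau> X2" "c = Poly_Mapping.lookup \<tau> X3"
      have "(c + 1, b + c + 1) \<in> support \<pi>"
        using drop[OF \<tau>(1)] by (simp add: supp bc)
      then show "\<sigma> \<in> (\<lambda>(i, j). mon 0 (j - i) (i - 1)) ` support \<pi>"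
        by (rule rev_image_eqI) (simp add: \<tau>(2) bc mon_def)
    qed
  qed
  then have 2: "card (?g ` terms_below \<pi>) = card (support \<pi>)"
    by (simp add: bij_betw_same_card)
  let ?g3 = "\<lambda>\<gamma> :: pterm. Poly_Mapping.single X3 (Poly_Mapping.lookup \<gamma> X3)"
  have "bij_betw (\<lambda>i. mon 0 0 (i - 1)) (fst ` support \<pi>) (?g3 ` terms_below \<pi>)"
    unfolding bij_betw_def
  proof
    show "inj_on (\<lambda>i. mon 0 0 (i - 1)) (fst ` support \<pi>)"
      by (rule inj_onI) (auto simp: supp)
    show "(\<lambda>i. mon 0 0 (i - 1)) ` fst ` support \<pi> = ?g3 ` terms_below \<pi>"
    proof (intro equalityI subsetI)
      fix \<sigma> assume "\<sigma> \<in> (\<lambda>i. mon 0 0 (i - 1)) ` fst ` support \<pi>"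
      then obtain i j where "(i, j) \<in> support \<pi>" "\<sigma> = mon 0 0 (i - 1)" by auto
      then show "\<sigma> \<in> ?g3 ` terms_below \<pi>"
        \<comment> \<open>Any cell of row \<open>i\<close> supplies a term with the required
          exponent of \<open>X3\<close>.\<close>
        by (intro rev_image_eqI[of "mon 0 (j - i) (i - 1)"])
          (simp_all add: supp pterm_eq_iff lookup_single)
    next
      fix \<sigma> assume "\<sigma> \<in> ?g3 ` terms_below \<pi>"
      then obtain \<tau> where \<tau>: "\<tau> \<in> terms_below \<pi>" "\<sigma> = ?g3 \<tau>" by auto
      define b c where bc: "b = Poly_Mapping.lookup \<tau> X2" "c = Poly_Mapping.lookup \<tau> X3"
      have "(c + 1, b + c + 1) \<in> support \<pi>"
        using drop[OF \<tau>(1)] by (simp add: supp bc)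
      then have "c + 1 \<in> fst ` support \<pi>"
        by (rule rev_image_eqI) simp
      then show "\<sigma> \<in> (\<lambda>i. mon 0 0 (i - 1)) ` fst ` support \<pi>"
        by (rule rev_image_eqI) (simp add: \<tau>(2) bc mon_def)
    qed
  qed
  then have 3: "card (?g3 ` terms_below \<pi>) = card (fst ` support \<pi>)"
    by (simp add: bij_betw_same_card)
  show ?thesis
    using 1 2 3 by (simp add: bar_list_def)
qed

end

section \<open>The shifted array of a stable order ideal\<close>

context
  fixes N :: "pterm set"
  assumes ord: "order_ideal N" and fin: "finite N"
begin

text \<open>Over fixed \<open>b\<close> and \<open>c\<close> the exponents of \<open>X1\<close> are
  finite in number and closed under predecessors, so they form an initial segment.\<close>

lemma mon_mem_iff: "mon a b c \<in> N \<longleftrightarrow> a < card {a. mon a b c \<in> N}"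
proof -
  have "finite {a. mon a b c \<in> N}"
    using fin by (rule finite_vimageI[of N "\<lambda>a. mon a b c", unfolded vimage_def]) (simp add: inj_on_def)
  then have "{a. mon a b c \<in> N} = {0..<0 + card {a. mon a b c \<in> N}}"
    by (rule eq_atLeastLessThan_if_down_closed) (auto intro: order_ideal_mon[OF ord])
  then show ?thesis by auto
qed

lemma terms_below_heights: "terms_below (heights N) = N"
proof -
  have "mon a b c \<in> terms_below (heights N) \<longleftrightarrow> mon a b c \<in> N" for a b c
    unfolding mon_mem_terms_below mon_mem_iff[of a b c] by (simp add: heights_def)
  then have "\<tau> \<in> terms_below (heights N) \<longleftrightarrow> \<tau> \<in> N" for \<tau>
    by (metis mon_lookup)
  then show ?thesis by blast
qed

lemma shifted_array_heights:
  assumes st: "stable_terms N"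
  shows "shifted_array (heights N)"
proof -
  define n where "n b c = card {a. mon a b c \<in> N}" for b c
  have mem: "mon a b c \<in> N \<longleftrightarrow> a < n b c" for a b c
    unfolding n_def by (rule mon_mem_iff)
  \<comment> \<open>The largest exponent over \<open>(Suc b, c)\<close> is
    \<open>n (Suc b) c - 1\<close>; exchanging one \<open>X2\<close> for \<open>X1\<close> turns it
    into the exponent \<open>n (Suc b) c\<close> over \<open>(b, c)\<close>.\<close>
  have row: "n (Suc b) c < n b c" if "n (Suc b) c \<noteq> 0" for b c
    using stable_terms_mon(1)[OF st, of "n (Suc b) c - 1" b c] that by (simp add: mem)
  \<comment> \<open>Exchanging \<open>X3\<close> for \<open>X2\<close> keeps the exponent of
    \<open>X1\<close>, so the first exponent missing over \<open>(Suc b, c)\<close> cannot occur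
    over \<open>(b, Suc c)\<close>.\<close>
  have col: "n b (Suc c) \<le> n (Suc b) c" for b c
  proof (rule ccontr)
    assume "\<not> n b (Suc c) \<le> n (Suc b) c"
    then have "mon (n (Suc b) c) b (Suc c) \<in> N"
      by (simp add: mem)
    then have "mon (n (Suc b) c) (Suc b) c \<in> N"
      by (rule stable_terms_mon(2)[OF st])
    then show False
      by (simp add: mem)
  qed
  have h: "heights N i j = (if 1 \<le> i \<and> i \<le> j then int (n (j - i) (i - 1)) else 0)" for i j
    by (simp add: heights_def n_def)
  show ?thesis
    unfolding shifted_array_def
  proof (intro conjI allI impI)
    fix i j :: nat assume "1 \<le> i" "i \<le> j" "heights N i (j + 1) \<noteq> 0"
    then show "heights N i (j + 1) < heights N i j"
      using row[of "j - i" "i - 1"] by (simp add: h Suc_diff_le)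
  next
    fix i j :: nat assume "1 \<le> i" "i < j"
    then show "heights N (i + 1) j \<le> heights N i j"
      using col[of "j - Suc i" "i - 1"] by (simp add: h Suc_diff_Suc)
  qed (auto simp: h split: if_splits)
qed

end

lemma bij_betw_terms_below:
  "bij_betw terms_below (shifted_arrays p h k)
     {N. order_ideal N \<and> stable_terms N \<and> finite N \<and> bar_list N = (p, h, k)}"
proof (rule bij_betw_byWitness[where f' = heights])
  show "\<forall>\<pi> \<in> shifted_arrays p h k. heights (terms_below \<pi>) = \<pi>"
    by (auto simp: shifted_arrays_def heights_terms_below)
  show "\<forall>N \<in> {N. order_ideal N \<and> stable_terms N \<and> finite N \<and> bar_list N = (p, h, k)}.
      terms_below (heights N) = N"
    by (auto simp: terms_below_heights)
  show "terms_below ` shifted_arrays p h k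
      \<subseteq> {N. order_ideal N \<and> stable_terms N \<and> finite N \<and> bar_list N = (p, h, k)}"
    by (auto simp: shifted_arrays_def order_ideal_terms_below stable_terms_terms_below
        finite_terms_below_iff bar_list_terms_below)
  show "heights ` {N. order_ideal N \<and> stable_terms N \<and> finite N \<and> bar_list N = (p, h, k)}
      \<subseteq> shifted_arrays p h k"
  proof clarify
    fix N assume N: "order_ideal N" "stable_terms N" "finite N" "bar_list N = (p, h, k)"
    let ?\<pi> = "heights N"
    have arr: "shifted_array ?\<pi>"
      using N by (intro shifted_array_heights)
    have eq: "terms_below ?\<pi> = N"
      using N by (intro terms_below_heights)
    have fin: "finite (support ?\<pi>)"
      using finite_terms_below_iff[OF arr] N(3) by (simp add: eq)
    \<comment> \<open>The bar list yields only \<open>nat\<close> of this sum; nonnegativity turns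
      that into the sum being \<open>int p\<close>.\<close>
    have "(\<Sum>(i, j) \<in> support ?\<pi>. ?\<pi> i j) \<ge> 0"
      using shifted_array_nonneg[OF arr] by (intro sum_nonneg) auto
    then show "?\<pi> \<in> shifted_arrays p h k"
      using arr fin bar_list_terms_below[OF arr fin] N(4)
      by (simp add: eq shifted_arrays_def)
  qed
qed

theorem mainTheorem15:
  fixes p h k :: nat
  assumes "p > 0" and "h > 0" and "k > 0"
  shows "\<exists>f. bij_betw f
           (\<Union>\<alpha> \<in> strict_partitions h k. shifted_plane_partitions p \<alpha>)
           {J :: 'k::field_char_0 poly3 set.
              monomial_ideal J \<and> strongly_stable J \<and> finite (standard_terms J) \<and>
              bar_list (standard_terms J) = (p, h, k)}"
  unfolding UN_shifted_plane_partitions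
  \<comment> \<open>The witness is \<open>ideal_avoiding\<close> after
    \<open>terms_below\<close>.\<close>
  using bij_betw_trans[OF bij_betw_terms_below bij_betw_ideal_avoiding] by blast

end
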